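(* Let $\mathcal{H}$ be a separable complex Hilbert space, let $\{T(t)\}_{t\in\mathbb{R}}$ be a weakly measurable family of densely defined, closed operators in $\mathcal{H}$, and let $\boldsymbol{\mathcal{T}}$ be the associated maximally defined operator in $L^2(\mathbb{R};\mathcal{H})$. Then $\boldsymbol{\mathcal{T}}$ is densely defined if the linear subspace $$\mathcal{D}=\big\{f\in L^2(\mathbb{R};\mathcal{H})\,\big|\, f(t)\in\operatorname{dom}(T(t))\text{ for a.e. }t\in\mathbb{R}\big\}$$ is dense in $L^2(\mathbb{R};\mathcal{H})$.
   Context: The scalar product $(\cdot,\cdot)_{\mathcal{H}}$ is linear in the second argument. A family of vectors $\{g(t)\}_{t\in\mathbb{R}}\subset\mathcal{H}$ is called weakly measurable if $t\mapsto (h,g(t))_{\mathcal{H}}$ is Lebesgue measurable for every $h\in\mathcal{H}$. A family $\{T(t)\}_{t\in\mathbb{R}}$ of densely defined, closed, linear operators in $\mathcal{H}$ is called weakly measurable if for every weakly measurable family of vectors $\{f(t)\}_{t\in\mathbb{R}}$ in $\mathcal{H}$ with $f(t)\in\operatorname{dom}(T(t))$ for all $t\in\mathbb{R}$, the family of vectors $\{T(t)f(t)\}_{t\in\mathbb{R}}$ is weakly measurable. $L^2(\mathbb{R};\mathcal{H})$ is the Hilbert space of (a.e. equivalence classes of) weakly Lebesgue measurable functions $f:\mathbb{R}\to\mathcal{H}$ with $\int_{\mathbb{R}}\|f(t)\|_{\mathcal{H}}^2\,dt<\infty$. The operator $\boldsymbol{\mathcal{T}}$ in $L^2(\mathbb{R};\mathcal{H})$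 associated with $\{T(t)\}_{t\in\mathbb{R}}$ is maximally defined by $(\boldsymbol{\mathcal{T}}f)(t)=T(t)f(t)$ for a.e. $t\in\mathbb{R}$, with $$\operatorname{dom}(\boldsymbol{\mathcal{T}})=\Big\{g\in L^2(\mathbb{R};\mathcal{H})\,\Big|\, g(t)\in\operatorname{dom}(T(t))\text{ for a.e. }t\in\mathbb{R},\ t\mapsto T(t)g(t)\text{ is weakly measurable},\ \int_{\mathbb{R}}\|T(t)g(t)\|_{\mathcal{H}}^2\,dt<\infty\Big\}.$$ *)

theory Defs
  imports "HOL-Analysis.Analysis"
begin

class complex_vector = real_vector +
  fixes scaleC :: "complex \<Rightarrow> 'a \<Rightarrow> 'a" (infixr "*\<^sub>C" 75)
  assumes scaleC_add_right: "c *\<^sub>C (x + y) = c *\<^sub>C x + c *\<^sub>C y"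
    and scaleC_add_left: "(c + d) *\<^sub>C x = c *\<^sub>C x + d *\<^sub>C x"
    and scaleC_scaleC: "c *\<^sub>C d *\<^sub>C x = (c * d) *\<^sub>C x"
    and scaleC_of_real: "complex_of_real r *\<^sub>C x = r *\<^sub>R x"

text \<open>
  A complex inner product, linear in the second argument. Its real part is the real inner product
  of the library, so \<^class>\<open>real_inner\<close> supplies positive definiteness (\<open>cinner x x\<close> is real by
  \<open>cinner_commute\<close>), the norm \<open>sqrt (cinner x x)\<close> and the topology.
\<close>

class complex_inner = complex_vector + real_inner +
  fixes cinner :: "'a \<Rightarrow> 'a \<Rightarrow> complex"
  assumes cinner_commute: "cinner x y = cnj (cinner y x)"
    and cinner_add_right: "cinner x (y + z) = cinner x y + cinner x z"
    and cinner_scaleC_right: "cinner x (c *\<^sub>C y) = c * cinner x y"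
    and Re_cinner: "Re (cinner x y) = inner x y"

class chilbert_space = complex_inner + complete_space

class separable_chilbert_space = chilbert_space +
  assumes separable: "\<exists>S. countable S \<and> (\<forall>U. open U \<longrightarrow> U \<noteq> {} \<longrightarrow> (\<exists>x\<in>S. x \<in> U))"

definition csubspace :: "'a::complex_vector set \<Rightarrow> bool" where
  "csubspace S \<longleftrightarrow> 0 \<in> S \<and> (\<forall>x\<in>S. \<forall>y\<in>S. x + y \<in> S) \<and> (\<forall>c. \<forall>x\<in>S. c *\<^sub>C x \<in> S)"

text \<open>
  An operator, defined on a subset only, is a partial function \<open>A :: 'a \<rightharpoonup> 'a\<close> with domain
  \<open>dom A\<close>; its value at \<open>x \<in> dom A\<close> is \<open>the (A x)\<close>.
\<close>

definition linear_operator :: "('a::complex_vector \<rightharpoonup> 'a) \<Rightarrow> bool" where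
  "linear_operator A \<longleftrightarrow> csubspace (dom A) \<and>
     (\<forall>x\<in>dom A. \<forall>y\<in>dom A. the (A (x + y)) = the (A x) + the (A y)) \<and>
     (\<forall>c. \<forall>x\<in>dom A. the (A (c *\<^sub>C x)) = c *\<^sub>C the (A x))"

definition densely_defined :: "('a::topological_space \<rightharpoonup> 'a) \<Rightarrow> bool" where
  "densely_defined A \<longleftrightarrow> closure (dom A) = UNIV"

definition closed_operator :: "('a::topological_space \<rightharpoonup> 'a) \<Rightarrow> bool" where
  "closed_operator A \<longleftrightarrow> closed (Map.graph A)"

definition weakly_measurable :: "(real \<Rightarrow> 'a::complex_inner) \<Rightarrow> bool" where
  "weakly_measurable g \<longleftrightarrow> (\<forall>h. (\<lambda>t. cinner h (g t)) \<in> borel_measurable lebesgue)"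

definition weakly_measurable_family :: "(real \<Rightarrow> 'a::complex_inner \<rightharpoonup> 'a) \<Rightarrow> bool" where
  "weakly_measurable_family T \<longleftrightarrow>
     (\<forall>f. weakly_measurable f \<longrightarrow> (\<forall>t. f t \<in> dom (T t)) \<longrightarrow>
          weakly_measurable (\<lambda>t. the (T t (f t))))"

definition square_integrable :: "(real \<Rightarrow> 'a::complex_inner) \<Rightarrow> bool" where
  "square_integrable f \<longleftrightarrow>
     weakly_measurable f \<and> integrable lebesgue (\<lambda>t. (norm (f t))\<^sup>2)"


subsection \<open>Inner product algebra\<close>

lemma scaleC_one [simp]: "1 *\<^sub>C x = (x :: 'a::complex_vector)"
  using scaleC_of_real[of 1 x] by simp

lemma scaleC_minus_one: "(-1) *\<^sub>C x = - (x :: 'a::complex_vector)"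
  using scaleC_of_real[of "-1" x] by simp

lemma scaleC_zero_right [simp]: "c *\<^sub>C (0 :: 'a::complex_vector) = 0"
  using scaleC_add_right[of c 0 "0::'a"] by simp

lemma cinner_zero_right [simp]: "cinner x 0 = (0::complex)" for x :: "'a::complex_inner"
  using cinner_add_right[of x 0 0] by simp

lemma cinner_minus_right: "cinner x (- y) = - cinner x y" for x :: "'a::complex_inner"
  using cinner_scaleC_right[of x "-1" y] by (simp add: scaleC_minus_one)

lemma cinner_diff_right: "cinner x (y - z) = cinner x y - cinner x z" for x :: "'a::complex_inner"
  using cinner_add_right[of x y "-z"] by (simp add: cinner_minus_right)

lemma cinner_self: "cinner x x = complex_of_real ((norm x)\<^sup>2)" for x :: "'a::complex_inner"
proof (rule complex_eqI)
  show "Re (cinner x x) = Re (complex_of_real ((norm x)\<^sup>2))"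
    by (simp add: Re_cinner power2_norm_eq_inner)
  have "Im (cinner x x) = - Im (cinner x x)"
    using arg_cong[OF cinner_commute[of x x], of Im] by simp
  then show "Im (cinner x x) = Im (complex_of_real ((norm x)\<^sup>2))"
    by simp
qed

lemma Im_cinner: "Im (cinner x y) = - inner x (\<i> *\<^sub>C y)" for x :: "'a::complex_inner"
  unfolding Re_cinner[symmetric] cinner_scaleC_right by simp

lemma norm_scaleC: "norm (c *\<^sub>C x) = cmod c * norm x" for x :: "'a::complex_inner"
proof -
  have "cinner (c *\<^sub>C x) (c *\<^sub>C x) = c * cnj (c * cinner x x)"
    unfolding cinner_scaleC_right[of "c *\<^sub>C x"] cinner_commute[of "c *\<^sub>C x" x] cinner_scaleC_right ..
  also have "\<dots> = c * cnj c * complex_of_real ((norm x)\<^sup>2)"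
    unfolding cinner_self by simp
  also have "\<dots> = complex_of_real ((cmod c * norm x)\<^sup>2)"
    unfolding complex_norm_square[symmetric] by (simp add: power_mult_distrib)
  finally have "(norm (c *\<^sub>C x))\<^sup>2 = (cmod c * norm x)\<^sup>2"
    unfolding cinner_self of_real_eq_iff .
  then show ?thesis
    by (simp add: power2_eq_iff_nonneg)
qed

lemma Cauchy_Schwarz_cinner: "cmod (cinner x y) \<le> norm x * norm y" for x :: "'a::complex_inner"
proof (cases "cinner x y = 0")
  case False
  define c where "c = cnj (sgn (cinner x y))"
  have c: "cmod c = 1" using False by (simp add: c_def norm_sgn)
  have "c * cinner x y = complex_of_real (cmod (cinner x y))"
  proof -
    have "c * cinner x y = cnj (cinner x y) * cinner x y / cmod (cinner x y)"
      by (simp add: c_def sgn_eq)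
    also have "cnj (cinner x y) * cinner x y = complex_of_real ((cmod (cinner x y))\<^sup>2)"
      unfolding complex_norm_square by (rule mult.commute)
    finally show ?thesis by (simp add: power2_eq_square)
  qed
  then have "cmod (cinner x y) = inner x (c *\<^sub>C y)"
    unfolding Re_cinner[symmetric] cinner_scaleC_right by simp
  also have "\<dots> \<le> norm x * norm (c *\<^sub>C y)"
    by (rule norm_cauchy_schwarz)
  finally show ?thesis by (simp add: norm_scaleC c)
qed simp


lemma countable_dense_closure:
  "\<exists>S::'a::separable_chilbert_space set. countable S \<and> closure S = UNIV"
proof -
  obtain S :: "'a set" where S: "countable S" "\<And>U. open U \<Longrightarrow> U \<noteq> {} \<Longrightarrow> \<exists>x\<in>S. x \<in> U"
    using separable by blast
  have "x \<in> closure S" for x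
    unfolding closure_iff_nhds_not_empty
  proof (intro allI impI)
    fix A U :: "'a set"
    assume "U \<subseteq> A" "open U" "x \<in> U"
    then show "S \<inter> A \<noteq> {}" using S(2)[of U] by blast
  qed
  then show ?thesis using S(1) by auto
qed


subsection \<open>Square-integrable functions\<close>

lemma weakly_measurable_add:
  "weakly_measurable f \<Longrightarrow> weakly_measurable g \<Longrightarrow> weakly_measurable (\<lambda>t. f t + g t)"
  unfolding weakly_measurable_def by (auto simp: cinner_add_right intro!: borel_measurable_add)

lemma weakly_measurable_scaleC:
  "weakly_measurable f \<Longrightarrow> weakly_measurable (\<lambda>t. c *\<^sub>C f t)"
  unfolding weakly_measurable_def
  by (auto simp: cinner_scaleC_right intro!: borel_measurable_times borel_measurable_const)

lemma weakly_measurable_zero: "weakly_measurable (\<lambda>t. 0)"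
  unfolding weakly_measurable_def by simp

lemma weakly_measurable_cong_AE:
  assumes "weakly_measurable f" "AE t in lebesgue. f t = g t"
  shows "weakly_measurable g"
  unfolding weakly_measurable_def
proof
  fix h
  show "(\<lambda>t. cinner h (g t)) \<in> borel_measurable lebesgue"
  proof (rule borel_measurable_AE)
    show "(\<lambda>t. cinner h (f t)) \<in> borel_measurable lebesgue"
      using assms(1) by (simp add: weakly_measurable_def)
    show "AE t in lebesgue. cinner h (f t) = cinner h (g t)"
      using assms(2) by eventually_elim simp
  qed
qed

lemma norm_measurable:
  fixes f :: "real \<Rightarrow> 'a::separable_chilbert_space"
  assumes "weakly_measurable f"
  shows "(\<lambda>t. norm (f t)) \<in> borel_measurable lebesgue"
proof -
  obtain S :: "'a set" where S: "countable S" "closure S = UNIV"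
    using countable_dense_closure by blast
  have le_iff: "norm y \<le> r \<longleftrightarrow> (\<forall>h\<in>S. \<bar>inner h y\<bar> \<le> r * norm h)" if "0 \<le> r" for r and y :: 'a
  proof
    assume "norm y \<le> r"
    then have "norm h * norm y \<le> r * norm h" for h :: 'a
      using mult_left_mono[of "norm y" r "norm h"] by (simp add: mult.commute)
    then show "\<forall>h\<in>S. \<bar>inner h y\<bar> \<le> r * norm h"
      using Cauchy_Schwarz_ineq2 order_trans by blast
  next
    assume *: "\<forall>h\<in>S. \<bar>inner h y\<bar> \<le> r * norm h"
    have "closed {h. \<bar>inner h y\<bar> \<le> r * norm h}"
      by (intro closed_Collect_le continuous_intros)
    then have "closure S \<subseteq> {h. \<bar>inner h y\<bar> \<le> r * norm h}"
      using * by (intro closure_minimal) auto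
    then have "\<bar>inner y y\<bar> \<le> r * norm y"
      unfolding S(2) by blast
    then have "norm y * norm y \<le> r * norm y"
      by (simp add: dot_square_norm power2_eq_square)
    then show "norm y \<le> r"
      using that by (cases "norm y = 0") (auto simp: mult_le_cancel_right)
  qed
  have inner_meas: "(\<lambda>t. inner h (f t)) \<in> borel_measurable lebesgue" for h
    using assms unfolding weakly_measurable_def borel_measurable_complex_iff Re_cinner by blast
  have "{t \<in> space lebesgue. norm (f t) \<le> r} \<in> sets lebesgue" for r
  proof (cases "0 \<le> r")
    case True
    have "{t \<in> space lebesgue. \<forall>h\<in>S. \<bar>inner h (f t)\<bar> \<le> r * norm h} \<in> sets lebesgue"
      using S(1) inner_meas by measurable
    then show ?thesis by (simp add: le_iff[OF True])
  next
    case False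
    then have "{t \<in> space lebesgue. norm (f t) \<le> r} = {}"
      using norm_ge_zero order_trans by blast
    then show ?thesis by simp
  qed
  then show ?thesis by (simp add: borel_measurable_iff_le)
qed

lemma inner_measurable:
  fixes f g :: "real \<Rightarrow> 'a::separable_chilbert_space"
  assumes "weakly_measurable f" "weakly_measurable g"
  shows "(\<lambda>t. inner (f t) (g t)) \<in> borel_measurable lebesgue"
proof -
  have "(\<lambda>t. inner (f t) (g t)) =
      (\<lambda>t. ((norm (f t + g t))\<^sup>2 - (norm (f t))\<^sup>2 - (norm (g t))\<^sup>2) / 2)"
    by (simp add: fun_eq_iff power2_norm_eq_inner inner_add_left inner_add_right inner_commute)
  moreover note [measurable] = norm_measurable[OF assms(1)] norm_measurable[OF assms(2)]
    norm_measurable[OF weakly_measurable_add[OF assms]]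
  ultimately show ?thesis by simp
qed

lemma cinner_measurable:
  fixes f g :: "real \<Rightarrow> 'a::separable_chilbert_space"
  assumes "weakly_measurable f" "weakly_measurable g"
  shows "(\<lambda>t. cinner (f t) (g t)) \<in> borel_measurable lebesgue"
  unfolding borel_measurable_complex_iff Im_cinner Re_cinner
  using inner_measurable[OF assms] inner_measurable[OF assms(1) weakly_measurable_scaleC[OF assms(2)]]
  by auto

lemma square_integrable_cong_AE:
  fixes f g :: "real \<Rightarrow> 'a::separable_chilbert_space"
  assumes "square_integrable f" "AE t in lebesgue. f t = g t"
  shows "square_integrable g"
proof -
  have g: "weakly_measurable g"
    using assms weakly_measurable_cong_AE square_integrable_def by blast
  note [measurable] = norm_measurable[OF g]
  have "integrable lebesgue (\<lambda>t. (norm (f t))\<^sup>2)"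
    using assms(1) by (simp add: square_integrable_def)
  then have "integrable lebesgue (\<lambda>t. (norm (g t))\<^sup>2)"
    by (rule integrable_cong_AE_imp) (use assms(2) in \<open>auto elim: eventually_mono\<close>)
  then show ?thesis
    using g by (simp add: square_integrable_def)
qed

lemma square_integrable_zero: "square_integrable (\<lambda>t. 0)"
  by (simp add: square_integrable_def weakly_measurable_zero)

lemma square_integrable_add:
  fixes f g :: "real \<Rightarrow> 'a::separable_chilbert_space"
  assumes "square_integrable f" "square_integrable g"
  shows "square_integrable (\<lambda>t. f t + g t)"
proof -
  have fg: "weakly_measurable (\<lambda>t. f t + g t)"
    using assms weakly_measurable_add square_integrable_def by blast
  note [measurable] = norm_measurable[OF fg]
  have "integrable lebesgue (\<lambda>t. 2 * (norm (f t))\<^sup>2 + 2 * (norm (g t))\<^sup>2)"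
    using assms by (simp add: square_integrable_def)
  moreover have "(norm (f t + g t))\<^sup>2 \<le> 2 * (norm (f t))\<^sup>2 + 2 * (norm (g t))\<^sup>2" for t
  proof -
    have "(norm (f t + g t))\<^sup>2 \<le> (norm (f t) + norm (g t))\<^sup>2"
      by (simp add: norm_triangle_ineq power_mono)
    also have "\<dots> \<le> 2 * (norm (f t))\<^sup>2 + 2 * (norm (g t))\<^sup>2"
      using sum_squares_bound[of "norm (f t)" "norm (g t)"] by (simp add: power2_sum)
    finally show ?thesis .
  qed
  ultimately have "integrable lebesgue (\<lambda>t. (norm (f t + g t))\<^sup>2)"
    by (auto intro: Bochner_Integration.integrable_bound)
  then show ?thesis
    using fg by (simp add: square_integrable_def)
qed

lemma square_integrable_scaleC:
  fixes f :: "real \<Rightarrow> 'a::separable_chilbert_space"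
  assumes "square_integrable f"
  shows "square_integrable (\<lambda>t. c *\<^sub>C f t)"
  using assms by (simp add: square_integrable_def weakly_measurable_scaleC norm_scaleC power_mult_distrib)

lemma cinner_integrable:
  fixes f g :: "real \<Rightarrow> 'a::separable_chilbert_space"
  assumes "square_integrable f" "square_integrable g"
  shows "integrable lebesgue (\<lambda>t. cinner (f t) (g t))"
proof (rule Bochner_Integration.integrable_bound)
  show "integrable lebesgue (\<lambda>t. (norm (f t))\<^sup>2 + (norm (g t))\<^sup>2)"
    using assms by (simp add: square_integrable_def)
  show "(\<lambda>t. cinner (f t) (g t)) \<in> borel_measurable lebesgue"
    using assms by (simp add: cinner_measurable square_integrable_def)
  have "cmod (cinner (f t) (g t)) \<le> (norm (f t))\<^sup>2 + (norm (g t))\<^sup>2" for t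
  proof -
    have "2 * norm (f t) * norm (g t) \<le> (norm (f t))\<^sup>2 + (norm (g t))\<^sup>2"
      by (rule sum_squares_bound)
    moreover have "0 \<le> norm (f t) * norm (g t)" by simp
    ultimately show ?thesis
      using Cauchy_Schwarz_cinner[of "f t" "g t"] by linarith
  qed
  then show "AE t in lebesgue. norm (cinner (f t) (g t)) \<le> norm ((norm (f t))\<^sup>2 + (norm (g t))\<^sup>2)"
    by auto
qed

lemma integral_cinner_self:
  "(\<integral>t. cinner (f t) (f t) \<partial>lebesgue) = complex_of_real (\<integral>t. (norm (f t))\<^sup>2 \<partial>lebesgue)"
  unfolding cinner_self by (rule integral_complex_of_real)


subsection \<open>The space \<open>L\<^sup>2(\<real>; H)\<close>\<close>

quotient_type (overloaded) 'a L2 = "real \<Rightarrow> 'a::separable_chilbert_space" / partial: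
  "\<lambda>f g. square_integrable f \<and> square_integrable g \<and> (AE t in lebesgue. f t = g t)"
proof (rule part_equivpI)
  show "\<exists>f::real \<Rightarrow> 'a. square_integrable f \<and> square_integrable f \<and> (AE t in lebesgue. f t = f t)"
    using square_integrable_zero by auto
  show "symp (\<lambda>f g::real \<Rightarrow> 'a. square_integrable f \<and> square_integrable g \<and> (AE t in lebesgue. f t = g t))"
    by (auto intro!: sympI elim: eventually_mono)
  show "transp (\<lambda>f g::real \<Rightarrow> 'a. square_integrable f \<and> square_integrable g \<and> (AE t in lebesgue. f t = g t))"
  proof (rule transpI)
    fix f g h :: "real \<Rightarrow> 'a"
    assume *: "square_integrable f \<and> square_integrable g \<and> (AE t in lebesgue. f t = g t)"
      "square_integrable g \<and> square_integrable h \<and> (AE t in lebesgue. g t = h t)"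
    from * have "AE t in lebesgue. f t = g t" "AE t in lebesgue. g t = h t" by auto
    then have "AE t in lebesgue. f t = h t" by eventually_elim simp
    with * show "square_integrable f \<and> square_integrable h \<and> (AE t in lebesgue. f t = h t)" by simp
  qed
qed

instantiation L2 :: (separable_chilbert_space) complex_inner
begin

lift_definition zero_L2 :: "'a L2" is "\<lambda>t. 0"
  by (simp add: square_integrable_zero)

lift_definition plus_L2 :: "'a L2 \<Rightarrow> 'a L2 \<Rightarrow> 'a L2" is "\<lambda>f g t. f t + g t"
  by (auto simp: square_integrable_add elim: eventually_elim2)

lift_definition scaleC_L2 :: "complex \<Rightarrow> 'a L2 \<Rightarrow> 'a L2" is "\<lambda>c f t. c *\<^sub>C f t"
  by (auto simp: square_integrable_scaleC elim: eventually_mono)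

lift_definition cinner_L2 :: "'a L2 \<Rightarrow> 'a L2 \<Rightarrow> complex" is
  "\<lambda>f g. \<integral>t. cinner (f t) (g t) \<partial>lebesgue"
proof -
  fix f f' g g' :: "real \<Rightarrow> 'a"
  assume *: "square_integrable f \<and> square_integrable f' \<and> (AE t in lebesgue. f t = f' t)"
    "square_integrable g \<and> square_integrable g' \<and> (AE t in lebesgue. g t = g' t)"
  then have "AE t in lebesgue. f t = f' t" "AE t in lebesgue. g t = g' t" by auto
  then have "AE t in lebesgue. cinner (f t) (g t) = cinner (f' t) (g' t)"
    by eventually_elim simp
  then show "(\<integral>t. cinner (f t) (g t) \<partial>lebesgue) = (\<integral>t. cinner (f' t) (g' t) \<partial>lebesgue)"
    using * by (intro integral_cong_AE) (auto simp: cinner_measurable square_integrable_def)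
qed

definition scaleR_L2 :: "real \<Rightarrow> 'a L2 \<Rightarrow> 'a L2" where
  "scaleR_L2 r f = complex_of_real r *\<^sub>C f"

definition uminus_L2 :: "'a L2 \<Rightarrow> 'a L2" where
  "uminus_L2 f = (-1) *\<^sub>C f"

definition minus_L2 :: "'a L2 \<Rightarrow> 'a L2 \<Rightarrow> 'a L2" where
  "minus_L2 f g = f + - (g :: 'a L2)"

definition inner_L2 :: "'a L2 \<Rightarrow> 'a L2 \<Rightarrow> real" where
  "inner_L2 f g = Re (cinner f g)"

definition norm_L2 :: "'a L2 \<Rightarrow> real" where
  "norm_L2 f = sqrt (inner f f)"

definition sgn_L2 :: "'a L2 \<Rightarrow> 'a L2" where
  "sgn_L2 f = inverse (norm f) *\<^sub>R f"

definition dist_L2 :: "'a L2 \<Rightarrow> 'a L2 \<Rightarrow> real" where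
  "dist_L2 f g = norm (f - g)"

definition uniformity_L2 :: "('a L2 \<times> 'a L2) filter" where
  "uniformity_L2 = (INF e\<in>{0<..}. principal {(f, g). dist f g < e})"

definition open_L2 :: "'a L2 set \<Rightarrow> bool" where
  "open_L2 U \<longleftrightarrow> (\<forall>f\<in>U. eventually (\<lambda>(f', g). f' = f \<longrightarrow> g \<in> U) uniformity)"

instance
proof
  fix f g h :: "'a L2" and c d :: complex and r s :: real
  show "f + g + h = f + (g + h)"
    by transfer (auto simp: square_integrable_add add.assoc)
  show "f + g = g + f"
    by transfer (auto simp: square_integrable_add add.commute)
  show "0 + f = f"
    by transfer auto
  show "- f + f = 0"
    unfolding uminus_L2_def
    by transfer (auto simp: square_integrable_zero square_integrable_add square_integrable_scaleC scaleC_minus_one)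
  show "f - g = f + - g"
    by (simp add: minus_L2_def)
  show C_right: "c *\<^sub>C (f + g) = c *\<^sub>C f + c *\<^sub>C g" for c and f g :: "'a L2"
    by transfer (auto simp: square_integrable_add square_integrable_scaleC scaleC_add_right)
  show C_left: "(c + d) *\<^sub>C f = c *\<^sub>C f + d *\<^sub>C f" for c d and f :: "'a L2"
    by transfer (auto simp: square_integrable_add square_integrable_scaleC scaleC_add_left)
  show C_C: "c *\<^sub>C d *\<^sub>C f = (c * d) *\<^sub>C f" for c d and f :: "'a L2"
    by transfer (auto simp: square_integrable_scaleC scaleC_scaleC)
  have C_one: "1 *\<^sub>C f = f" for f :: "'a L2"
    by transfer auto
  show "complex_of_real r *\<^sub>C f = r *\<^sub>R f"
    by (simp add: scaleR_L2_def)
  show "r *\<^sub>R (f + g) = r *\<^sub>R f + r *\<^sub>R g" "(r + s) *\<^sub>R f = r *\<^sub>R f + s *\<^sub>R f"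
    "r *\<^sub>R s *\<^sub>R f = (r * s) *\<^sub>R f" "1 *\<^sub>R f = f"
    by (simp_all add: scaleR_L2_def C_right C_left C_C C_one)
  show commute: "cinner f g = cnj (cinner g f)" for f g :: "'a L2"
    by transfer (subst cinner_commute, simp)
  show add_right: "cinner f (g + h) = cinner f g + cinner f h" for f g h :: "'a L2"
    by transfer (auto simp: cinner_add_right cinner_integrable)
  show scale_right: "cinner f (c *\<^sub>C g) = c * cinner f g" for c and f g :: "'a L2"
    by transfer (auto simp: cinner_scaleC_right)
  show "Re (cinner f g) = inner f g"
    by (simp add: inner_L2_def)
  show commute': "inner f g = inner g f" for f g :: "'a L2"
    using commute[of f g] by (simp add: inner_L2_def)
  show "inner (f + g) h = inner f h + inner g h"
    unfolding commute'[of _ h] using add_right[of h f g] by (simp add: inner_L2_def)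
  show "inner (r *\<^sub>R f) g = r * inner f g"
    unfolding commute'[of _ g] using scale_right[of g "complex_of_real r" f]
    by (simp add: inner_L2_def scaleR_L2_def)
  show "0 \<le> inner f f"
    unfolding inner_L2_def by transfer (simp add: integral_cinner_self)
  show "inner f f = 0 \<longleftrightarrow> f = 0"
    unfolding inner_L2_def
    by transfer (auto simp: integral_cinner_self integral_nonneg_eq_0_iff_AE square_integrable_def
        weakly_measurable_zero)
  show "norm f = sqrt (inner f f)"
    by (rule norm_L2_def)
  show "sgn f = inverse (norm f) *\<^sub>R f"
    by (rule sgn_L2_def)
  show "dist f g = norm (f - g)"
    by (rule dist_L2_def)
  show "uniformity = (INF e\<in>{0<..}. principal {(f, g :: 'a L2). dist f g < e})"
    by (rule uniformity_L2_def)
  show "open U \<longleftrightarrow> (\<forall>f\<in>U. eventually (\<lambda>(f', g). f' = f \<longrightarrow> g \<in> U) uniformity)" for U :: "'a L2 set"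
    by (rule open_L2_def)
qed

end


subsection \<open>The operator in \<open>L\<^sup>2(\<real>; H)\<close> associated with a family of operators\<close>

lift_definition ae_in_dom :: "(real \<Rightarrow> 'a \<rightharpoonup> 'a) \<Rightarrow> 'a::separable_chilbert_space L2 \<Rightarrow> bool" is
  "\<lambda>T f. AE t in lebesgue. f t \<in> dom (T t)"
proof -
  fix T :: "real \<Rightarrow> 'a \<rightharpoonup> 'a" and f g :: "real \<Rightarrow> 'a"
  assume "square_integrable f \<and> square_integrable g \<and> (AE t in lebesgue. f t = g t)"
  then have *: "AE t in lebesgue. f t = g t" by blast
  show "(AE t in lebesgue. f t \<in> dom (T t)) = (AE t in lebesgue. g t \<in> dom (T t))"
  proof
    show "AE t in lebesgue. g t \<in> dom (T t)" if "AE t in lebesgue. f t \<in> dom (T t)"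
      using that * by eventually_elim simp
    show "AE t in lebesgue. f t \<in> dom (T t)" if "AE t in lebesgue. g t \<in> dom (T t)"
      using that * by eventually_elim simp
  qed
qed

text \<open>
  At the null set of points \<open>t\<close> with \<open>g t \<notin> dom (T t)\<close> the value \<open>the (T t (g t))\<close> is
  unspecified; this affects neither weak Lebesgue measurability nor the resulting a.e. class.
\<close>

lift_definition associated_operator ::
    "(real \<Rightarrow> 'a \<rightharpoonup> 'a) \<Rightarrow> 'a::separable_chilbert_space L2 \<rightharpoonup> 'a L2" is
  "\<lambda>T g. if (AE t in lebesgue. g t \<in> dom (T t)) \<and> square_integrable (\<lambda>t. the (T t (g t)))
         then Some (\<lambda>t. the (T t (g t))) else None"
proof -
  fix T :: "real \<Rightarrow> 'a \<rightharpoonup> 'a" and f g :: "real \<Rightarrow> 'a"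
  assume "square_integrable f \<and> square_integrable g \<and> (AE t in lebesgue. f t = g t)"
  then have *: "AE t in lebesgue. f t = g t" "AE t in lebesgue. g t = f t"
    by (auto elim: eventually_mono)
  have transfer_dom: "AE t in lebesgue. k t \<in> dom (T t)"
    if "AE t in lebesgue. h t = k t" "AE t in lebesgue. h t \<in> dom (T t)" for h k :: "real \<Rightarrow> 'a"
    using that by eventually_elim simp
  have transfer_AE: "AE t in lebesgue. the (T t (h t)) = the (T t (k t))"
    if "AE t in lebesgue. h t = k t" for h k :: "real \<Rightarrow> 'a"
    using that by eventually_elim simp
  have dom_iff: "(AE t in lebesgue. f t \<in> dom (T t)) \<longleftrightarrow> (AE t in lebesgue. g t \<in> dom (T t))"
    using transfer_dom * by blast
  have int_iff: "square_integrable (\<lambda>t. the (T t (f t))) \<longleftrightarrow> square_integrable (\<lambda>t. the (T t (g t)))"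
    by (rule iffI; erule square_integrable_cong_AE) (rule transfer_AE, rule *)+
  show "rel_option (\<lambda>f g. square_integrable f \<and> square_integrable g \<and> (AE t in lebesgue. f t = g t))
     (if (AE t in lebesgue. f t \<in> dom (T t)) \<and> square_integrable (\<lambda>t. the (T t (f t)))
      then Some (\<lambda>t. the (T t (f t))) else None)
     (if (AE t in lebesgue. g t \<in> dom (T t)) \<and> square_integrable (\<lambda>t. the (T t (g t)))
      then Some (\<lambda>t. the (T t (g t))) else None)"
    unfolding dom_iff int_iff using transfer_AE[OF *(1)] int_iff by simp
qed

lemma csubspace_ae_in_dom:
  fixes T :: "real \<Rightarrow> 'a::separable_chilbert_space \<rightharpoonup> 'a"
  assumes "\<And>t. linear_operator (T t)"
  shows "csubspace {f. ae_in_dom T f}"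
proof -
  have dom: "0 \<in> dom (T t)" "x \<in> dom (T t) \<Longrightarrow> y \<in> dom (T t) \<Longrightarrow> x + y \<in> dom (T t)"
    "x \<in> dom (T t) \<Longrightarrow> c *\<^sub>C x \<in> dom (T t)" for t x y c
    using assms[of t] unfolding linear_operator_def csubspace_def by blast+
  have "ae_in_dom T 0"
    by (transfer fixing: T) (simp only: dom(1) eventually_True)
  moreover have "ae_in_dom T (f + g)" if "ae_in_dom T f" "ae_in_dom T g" for f g
    using that by (transfer fixing: T) (erule (1) eventually_elim2, erule (1) dom(2))
  moreover have "ae_in_dom T (c *\<^sub>C f)" if "ae_in_dom T f" for f c
    using that by (transfer fixing: T) (erule eventually_mono, erule dom(3))
  ultimately show ?thesis
    unfolding csubspace_def by blast
qed

end

theory Submission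
  imports Defs
begin

text \<open>
  Truncation: if \<open>f t \<in> dom (T t)\<close> for all \<open>t\<close>, let \<open>A n\<close> be the measurable set of those
  \<open>t \<in> [-n, n]\<close> with \<open>\<parallel>T t (f t)\<parallel> \<le> n\<close>. The function that equals \<open>f\<close> on \<open>A n\<close> and vanishes elsewhere
  is mapped by the family to a bounded function supported in \<open>[-n, n]\<close>, hence lies in the domain
  of the associated operator, and it converges to \<open>f\<close> by dominated convergence.
\<close>

text \<open>These two facts let a truncated function stay in the domains and make truncation commute
  with applying the family.\<close>

lemma linear_operator_zero:
  assumes "linear_operator A"
  shows "0 \<in> dom A" "the (A 0) = 0"
proof -
  show 0: "0 \<in> dom A"
    using assms unfolding linear_operator_def csubspace_def by blast
  then have "the (A (0 + 0)) = the (A 0) + the (A 0)"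
    using assms unfolding linear_operator_def by blast
  then show "the (A 0) = 0" by simp
qed

lemma weakly_measurable_if:
  assumes "weakly_measurable f" "A \<in> sets lebesgue"
  shows "weakly_measurable (\<lambda>t. if t \<in> A then f t else 0)"
  unfolding weakly_measurable_def
proof
  fix h
  have [measurable]: "(\<lambda>t. cinner h (f t)) \<in> borel_measurable lebesgue"
    using assms(1) by (simp add: weakly_measurable_def)
  have "(\<lambda>t. if t \<in> A then cinner h (f t) else 0) \<in> borel_measurable lebesgue"
    using assms(2) by measurable
  then show "(\<lambda>t. cinner h (if t \<in> A then f t else 0)) \<in> borel_measurable lebesgue"
    by (simp add: if_distrib cong: if_cong)
qed

lemma square_integrable_if:
  fixes f :: "real \<Rightarrow> 'a::separable_chilbert_space"
  assumes "square_integrable f" "A \<in> sets lebesgue"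
  shows "square_integrable (\<lambda>t. if t \<in> A then f t else 0)"
proof -
  have wm: "weakly_measurable (\<lambda>t. if t \<in> A then f t else 0)"
    using assms by (simp add: square_integrable_def weakly_measurable_if)
  have "integrable lebesgue (\<lambda>t. (norm (f t))\<^sup>2)"
    using assms(1) by (simp add: square_integrable_def)
  then have "integrable lebesgue (\<lambda>t. (norm (if t \<in> A then f t else 0))\<^sup>2)"
    by (rule Bochner_Integration.integrable_bound)
      (intro borel_measurable_power norm_measurable[OF wm], simp)
  with wm show ?thesis by (simp add: square_integrable_def)
qed

text \<open>The squared norm is dominated by \<open>C\<^sup>2\<close> times the indicator of an
  interval of finite measure.\<close>

lemma square_integrable_bounded_support:
  fixes f :: "real \<Rightarrow> 'a::separable_chilbert_space"
  assumes "weakly_measurable f"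
    and bound: "\<And>t. norm (f t) \<le> C"
    and support: "\<And>t. t \<notin> {a..b} \<Longrightarrow> f t = 0"
  shows "square_integrable f"
proof -
  note [measurable] = norm_measurable[OF assms(1)]
  have "integrable lebesgue (\<lambda>t. indicat_real {a..b} t *\<^sub>R C\<^sup>2)"
    by (rule integrable_indicator) (simp_all add: emeasure_lborel_Icc_eq)
  then have "integrable lebesgue (\<lambda>t. (norm (f t))\<^sup>2)"
  proof (rule Bochner_Integration.integrable_bound)
    show "(\<lambda>t. (norm (f t))\<^sup>2) \<in> borel_measurable lebesgue" by measurable
    have "(norm (f t))\<^sup>2 \<le> indicat_real {a..b} t *\<^sub>R C\<^sup>2" for t
      using power_mono[OF bound[of t] norm_ge_zero, of 2] support[of t]
      by (cases "t \<in> {a..b}") (simp_all add: indicator_def)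
    then show "AE t in lebesgue. norm ((norm (f t))\<^sup>2) \<le> norm (indicat_real {a..b} t *\<^sub>R C\<^sup>2)"
      by (auto intro: order_trans[OF _ abs_ge_self])
  qed
  with assms(1) show ?thesis by (simp add: square_integrable_def)
qed

text \<open>Reduces convergence of classes to convergence of ordinary integrals. Subtraction of
  classes unfolds to adding \<open>(-1) *\<^sub>C g\<close>, which explains the intermediate
  representative.\<close>

lemma norm_diff_abs_L2:
  assumes "square_integrable f" "square_integrable g"
  shows "(norm (abs_L2 f - abs_L2 g))\<^sup>2 = (\<integral>t. (norm (f t - g t))\<^sup>2 \<partial>lebesgue)"
proof -
  have m: "square_integrable (\<lambda>t. (-1) *\<^sub>C g t)"
    by (rule square_integrable_scaleC) fact
  have d: "square_integrable (\<lambda>t. f t + (-1) *\<^sub>C g t)"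
    by (rule square_integrable_add) fact+
  have "abs_L2 f - abs_L2 g = abs_L2 (\<lambda>t. f t + (-1) *\<^sub>C g t)"
    using assms m by (simp add: minus_L2_def uminus_L2_def scaleC_L2.abs_eq plus_L2.abs_eq)
  then have "(norm (abs_L2 f - abs_L2 g))\<^sup>2 =
      Re (cinner (abs_L2 (\<lambda>t. f t + (-1) *\<^sub>C g t)) (abs_L2 (\<lambda>t. f t + (-1) *\<^sub>C g t)))"
    by (simp add: power2_norm_eq_inner Re_cinner)
  also have "\<dots> = (\<integral>t. (norm (f t - g t))\<^sup>2 \<partial>lebesgue)"
    using d by (simp add: cinner_L2.abs_eq integral_cinner_self scaleC_minus_one)
  finally show ?thesis .
qed

text \<open>The squared error at \<open>t\<close> is \<open>0\<close> on \<open>A n\<close> and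
  \<open>(norm (f t))\<^sup>2\<close> elsewhere. It is therefore dominated by an integrable function
  independent of \<open>n\<close> and, for each fixed \<open>t\<close>, vanishes for all large
  \<open>n\<close>.\<close>

lemma abs_L2_if_tendsto:
  fixes f :: "real \<Rightarrow> 'a::separable_chilbert_space"
  assumes f: "square_integrable f"
    and A: "\<And>n. A n \<in> sets lebesgue"
    and eventually_mem: "\<And>t. \<forall>\<^sub>F n in sequentially. t \<in> A n"
  shows "(\<lambda>n. abs_L2 (\<lambda>t. if t \<in> A n then f t else 0)) \<longlonglongrightarrow> abs_L2 f"
proof -
  let ?g = "\<lambda>n t. if t \<in> A n then f t else 0"
  have [measurable]: "(\<lambda>t. norm (f t)) \<in> borel_measurable lebesgue"
    using f by (simp add: square_integrable_def norm_measurable)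
  note [measurable] = A
  have g: "square_integrable (?g n)" for n
    using f A by (rule square_integrable_if)
  have eq: "(norm (?g n t - f t))\<^sup>2 = (if t \<in> A n then 0 else (norm (f t))\<^sup>2)" for n t
    by simp
  have "(\<lambda>n. \<integral>t. (norm (?g n t - f t))\<^sup>2 \<partial>lebesgue) \<longlonglongrightarrow> (\<integral>t. (0::real) \<partial>(lebesgue :: real measure))"
    unfolding eq
  proof (rule integral_dominated_convergence)
    show "integrable lebesgue (\<lambda>t. (norm (f t))\<^sup>2)"
      using f by (simp add: square_integrable_def)
    show "AE t in lebesgue. (\<lambda>n. if t \<in> A n then 0 else (norm (f t))\<^sup>2) \<longlonglongrightarrow> 0"
      proof (intro AE_I2 tendsto_eventually)
      fix t
      show "\<forall>\<^sub>F n in sequentially. (if t \<in> A n then 0 else (norm (f t))\<^sup>2) = 0"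
        using eventually_mem[of t] by eventually_elim simp
    qed
    show "(\<lambda>t. if t \<in> A n then 0 else (norm (f t))\<^sup>2) \<in> borel_measurable lebesgue" for n
      by measurable
  qed simp_all
  then have "(\<lambda>n. (norm (abs_L2 (?g n) - abs_L2 f))\<^sup>2) \<longlonglongrightarrow> 0"
    unfolding norm_diff_abs_L2[OF g f] by simp
  then have "(\<lambda>n. norm (abs_L2 (?g n) - abs_L2 f)) \<longlonglongrightarrow> 0"
    by (simp add: power_tendsto_0_iff)
  then show ?thesis
    by (simp add: tendsto_norm_zero_iff LIM_zero_iff)
qed

lemma abs_L2_in_dom_associated_operator:
  assumes "square_integrable g" "\<And>t. g t \<in> dom (T t)" "square_integrable (\<lambda>t. the (T t (g t)))"
  shows "abs_L2 g \<in> dom (associated_operator T)"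
proof -
  have "AE t in lebesgue. g t \<in> dom (T t)"
    using assms(2) by simp
  then show ?thesis
    using assms(1,3) by (simp add: associated_operator.abs_eq dom_def)
qed

text \<open>Weak measurability of the family speaks only of functions lying in the domains at every
  \<open>t\<close>. Replacing the values on the exceptional null set by \<open>0\<close>, which
  belongs to every domain, provides such a representative of the same class.\<close>

lemma ae_in_dom_abs_L2E:
  assumes "\<And>t. 0 \<in> dom (T t)" "ae_in_dom T F"
  obtains f where "F = abs_L2 f" "square_integrable f" "\<And>t. f t \<in> dom (T t)"
proof -
  obtain h where h: "F = abs_L2 h" "square_integrable h"
    by (induction F rule: L2.abs_induct) blast
  then have ae: "AE t in lebesgue. h t \<in> dom (T t)"
    using assms(2) by (simp add: ae_in_dom.abs_eq)
  define f where "f t = (if h t \<in> dom (T t) then h t else 0)" for t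
  have "AE t in lebesgue. h t = f t"
    using ae by eventually_elim (simp add: f_def)
  moreover from h(2) this have f: "square_integrable f"
    by (rule square_integrable_cong_AE)
  ultimately have "F = abs_L2 f"
    using h Quotient3_rel_abs[OF Quotient3_L2] by blast
  moreover have "f t \<in> dom (T t)" for t
    using assms(1) by (simp add: f_def)
  ultimately show ?thesis
    using f that by blast
qed

lemma ae_in_dom_subset_closure_dom:
  fixes T :: "real \<Rightarrow> 'a::separable_chilbert_space \<rightharpoonup> 'a"
  assumes lin: "\<And>t. linear_operator (T t)"
    and meas: "weakly_measurable_family T"
  shows "{F. ae_in_dom T F} \<subseteq> closure (dom (associated_operator T))"
proof
  fix F
  assume "F \<in> {F. ae_in_dom T F}"
  then obtain f where F: "F = abs_L2 f" and f: "square_integrable f" "\<And>t. f t \<in> dom (T t)"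
    using ae_in_dom_abs_L2E linear_operator_zero(1)[OF lin] by (metis mem_Collect_eq)
  define k where "k t = the (T t (f t))" for t
  \<comment> \<open>The everywhere-defined representative pays off here: the hypothesis on the
    family applies to \<open>f\<close> directly.\<close>
  have k: "weakly_measurable k"
    using meas f unfolding weakly_measurable_family_def square_integrable_def k_def by blast
  note [measurable] = norm_measurable[OF k]
  \<comment> \<open>The interval gives the image finite-measure support and the second condition
    bounds it. Both are needed because \<open>k\<close> itself may fail to be square
    integrable.\<close>
  define A where "A n = {- real n..real n} \<inter> {t. norm (k t) \<le> real n}" for n
  have "{t \<in> space lebesgue. norm (k t) \<le> real n} \<in> sets lebesgue" for n
    by measurable
  then have A: "A n \<in> sets lebesgue" for n
    unfolding A_def by (intro sets.Int) simp_all
  have eventually_mem: "\<forall>\<^sub>F n in sequentially. t \<in> A n" for t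
    \<comment> \<open>From this index on, \<open>n\<close> exceeds or equals both
      \<open>\<bar>t\<bar>\<close> and the finite number \<open>norm (k t)\<close>.\<close>
    using eventually_ge_at_top[of "nat \<lceil>max \<bar>t\<bar> (norm (k t))\<rceil>"]
  proof eventually_elim
    case (elim n)
    then have "max \<bar>t\<bar> (norm (k t)) \<le> real n" by linarith
    then show ?case by (auto simp: A_def)
  qed
  let ?g = "\<lambda>n t. if t \<in> A n then f t else 0"
  have "abs_L2 (?g n) \<in> dom (associated_operator T)" for n
  proof (rule abs_L2_in_dom_associated_operator)
    show "square_integrable (?g n)"
      using f(1) A by (rule square_integrable_if)
    show "?g n t \<in> dom (T t)" for t
      using f(2) linear_operator_zero(1)[OF lin] by simp
    \<comment> \<open>Off \<open>A n\<close> the operator acts on \<open>0\<close> and returns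
      \<open>0\<close> by linearity, so the image of the truncation is the truncation of
      \<open>k\<close>.\<close>
    have Tg: "(\<lambda>t. the (T t (?g n t))) = (\<lambda>t. if t \<in> A n then k t else 0)"
      using linear_operator_zero(2)[OF lin] by (auto simp: k_def)
    show "square_integrable (\<lambda>t. the (T t (?g n t)))"
      unfolding Tg
      by (rule square_integrable_bounded_support[OF weakly_measurable_if[OF k A],
            of _ "real n" "- real n" "real n"]) (auto simp: A_def)
  qed
  moreover have "(\<lambda>n. abs_L2 (?g n)) \<longlonglongrightarrow> F"
    unfolding F by (rule abs_L2_if_tendsto[OF f(1) A eventually_mem])
  ultimately show "F \<in> closure (dom (associated_operator T))"
    unfolding closure_sequential by (intro exI[of _ "\<lambda>n. abs_L2 (?g n)"]) simp
qed

theorem corollary4p9: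
  fixes T :: "real \<Rightarrow> 'a::separable_chilbert_space \<rightharpoonup> 'a"
  assumes "\<And>t. linear_operator (T t)"
    and "\<And>t. densely_defined (T t)"
    and "\<And>t. closed_operator (T t)"
    and "weakly_measurable_family T"
    and "closure {f :: 'a L2. ae_in_dom T f} = UNIV"
  shows "densely_defined (associated_operator T)"
proof -
  \<comment> \<open>A closed set containing the dense subspace contains its closure, which is the
    whole space.\<close>
  have "closure {f. ae_in_dom T f} \<subseteq> closure (dom (associated_operator T))"
    using ae_in_dom_subset_closure_dom[OF assms(1,4)] by (rule closure_minimal) simp
  then show ?thesis
    unfolding densely_defined_def assms(5) by (rule top_le)
qed

end
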